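(* Let $n = \prod_{j=1}^m p_j^{k_j}$ be the number of states with its prime factorization ($n \in \mathbb{Z}_{\geq 2}$, $p_j$ distinct primes, $k_j \geq 1$). Suppose that $c \in \mathbb{Z}/n\mathbb{Z}$ satisfies $$c \in \left( \bigcap_{j \in I} p_j \mathbb{Z}/n\mathbb{Z} \right) \setminus \left( \bigcup_{j \in \bar{I}} p_j \mathbb{Z}/n\mathbb{Z} \right),$$ where $I \subsetneq \{1, 2, \dots, m\}$ is a proper subset of indices and $\bar{I} = \{1,\dots,m\}\setminus I$ is its complement. Let $\hat{c} = \prod_{j \in I} p_j^{k_j}$. Consider the canonical surjective ring homomorphism $\phi: \mathbb{Z}/n\mathbb{Z} \to \mathbb{Z}/(n/\hat{c})\mathbb{Z}$ defined by $\phi(a) = a \pmod{n/\hat{c}}$ for any $a \in \mathbb{Z}/n\mathbb{Z}$, and define the map $\Phi: (\mathbb{Z}/n\mathbb{Z})^{\mathbb{Z}^D \times \mathbb{Z}_{\geq 0}} \to (\mathbb{Z}/(n/\hat{c})\mathbb{Z})^{\mathbb{Z}^D \times \mathbb{Z}_{\geq 0}}$ induced by $\phi$ such that $$(\Phi \{T_{n,c}^t x_o\}_{t\ge 0})_{\boldsymbol{i},t} = \phi\big((T_{n,c}^t x_o)_{\boldsymbol{i}}\big)$$ for any orbit $\{T_{n,c}^t x_o\}_{t \geq 0}$ with spatial index $\boldsymbol{i}\in\mathbb{Z}^D$ and time step $t \in \mathbb{Z}_{\geq 0}$. Then the map $\Phi$ represents an algebraic reduction that commutes with the LCA-UW dynamics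 under the binary projection $\mathcal{B}$, and the following equality holds: $$\mathcal{B} (\{T_{n, c}^t x_o \}_{t \geq K_n}) = \mathcal{B} \circ \Phi (\{T_{n, c}^t x_o \}_{t \geq K_n}) = \mathcal{B} (\{T_{n/\hat{c}, 1}^t x_o \}_{t \geq K_n}),$$ where $K_n = \max_{1 \leq j \leq m} \{k_j\}$. Equivalently, the following diagram commutes: the square with top arrow $$\{T_{n, c}^t x_o \}_{t \geq K_n} \xrightarrow{\ \Phi\ } \{T_{n/\hat{c}, 1}^t x_o \}_{t \geq K_n},$$ left vertical arrow $$\{T_{n, c}^t x_o \}_{t \geq K_n} \xrightarrow{\ \mathcal{B}\ } \mathcal{B} (\{T_{n, c}^t x_o \}_{t \geq K_n}),$$ right vertical arrow $$\{T_{n/\hat{c}, 1}^t x_o \}_{t \geq K_n} \xrightarrow{\ \mathcal{B}\ } \mathcal{B} (\{T_{n/\hat{c}, 1}^t x_o \}_{t \geq K_n}),$$ and bottom edge the equality $$\mathcal{B} (\{T_{n, c}^t x_o \}_{t \geq K_n}) = \mathcal{B} (\{T_{n/\hat{c}, 1}^t x_o \}_{t \geq K_n}).$$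
   Context: Fix $D, J \in \mathbb{Z}_{\geq 1}$ and vectors $\boldsymbol{r}_1,\dots,\boldsymbol{r}_J \in \mathbb{Z}^D$ (the same for all automata considered). For $n \in \mathbb{Z}_{\ge 2}$ and nonzero $c \in \mathbb{Z}/n\mathbb{Z}$, the linear cellular automaton with uniform weights (LCA-UW) $T_{n,c} : (\mathbb{Z}/n\mathbb{Z})^{\mathbb{Z}^D} \to (\mathbb{Z}/n\mathbb{Z})^{\mathbb{Z}^D}$ is defined by $(T_{n,c}x)_{\boldsymbol{i}} = \sum_{j=1}^J c\, x_{\boldsymbol{i}+\boldsymbol{r}_j} \pmod n$ for $\boldsymbol{i}\in\mathbb{Z}^D$; $T_{n,c}^t$ is its $t$-th iterate. The single-site seed $x_o$ (in any state ring) is the configuration with value $1$ at $\boldsymbol{0}$ and $0$ elsewhere. The orbit of $x_o$ is $\{T_{n,c}^t x_o\}_{t\ge 0}$, regarded as a space-time configuration indexed by $(\boldsymbol{i},t) \in \mathbb{Z}^D\times\mathbb{Z}_{\ge 0}$. For a prime $p$ dividing $n$, $p\mathbb{Z}/n\mathbb{Z} = \{pa \bmod n : a \in \mathbb{Z}/n\mathbb{Z}\}$ is the principal ideal generated by $p$ in $\mathbb{Z}/n\mathbb{Z}$; an intersection of such ideals over the empty index set is all of $\mathbb{Z}/n\mathbb{Z}$, and an empty product is $1$. The binary projection operator $\mathcal{B}$ sends a space-time configuration with values in $\mathbb{Z}/n\mathbb{Z}$ (for any $n$) to the $\{0,1\}$-valued space-time configuration that is $1$ at $(\boldsymbol{i},t)$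 if the value there is nonzero and $0$ if the value there is zero. For $K\ge 0$, the subscript $t\ge K$ denotes restriction to times $t \geq K$ and all sites $\boldsymbol{i} \in \mathbb{Z}^D$; equality of such objects means equality at all $(\boldsymbol{i},t)$ with $\boldsymbol{i}\in\mathbb{Z}^D$, $t \geq K$.
   Formalization: The top arrow of the diagram is read only after binary projection: Φ of the orbit of T_{n,c} and the orbit of T_{n/ĉ,1} agree under 𝓑, not literally (n=5, c=2, I empty is a counterexample to literal equality); both displayed equalities are stated in full. *)

theory Defs
  imports "HOL-Analysis.Finite_Cartesian_Product" "HOL-Number_Theory.Residues"
begin

text \<open>
  The ring of integers modulo \<open>n\<close> is \<^const>\<open>residue_ring\<close>, whose elements are the representatives
  \<open>0, \<dots>, n - 1\<close>. Configurations are functions on the lattice \<open>int ^ 'd\<close>, space-time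
  configurations are functions of a site and a time step.
\<close>

type_synonym 'd config = "int ^ 'd \<Rightarrow> int"
type_synonym 'd spacetime = "int ^ 'd \<Rightarrow> nat \<Rightarrow> int"

definition lca_uw :: "nat \<Rightarrow> (nat \<Rightarrow> int ^ 'd::finite) \<Rightarrow> int \<Rightarrow> int \<Rightarrow> 'd config \<Rightarrow> 'd config" where
  "lca_uw J r n c x = (\<lambda>i. (\<Sum>j = 1..J. c * x (i + r j)) mod n)"

definition seed :: "'d::finite config" where
  "seed = (\<lambda>i. if i = 0 then 1 else 0)"

definition seed_orbit :: "nat \<Rightarrow> (nat \<Rightarrow> int ^ 'd::finite) \<Rightarrow> int \<Rightarrow> int \<Rightarrow> 'd spacetime" where
  "seed_orbit J r n c = (\<lambda>i t. (lca_uw J r n c ^^ t) seed i)"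

text \<open>
  The generator is reduced modulo \<open>n\<close> because \<open>p = n\<close> is possible, and then \<open>p\<close> itself is not in
  the carrier.
\<close>

definition res_ideal :: "int \<Rightarrow> int \<Rightarrow> int set" where
  "res_ideal n p = PIdl\<^bsub>residue_ring n\<^esub> (p mod n)"

lemma res_ideal_eq: "res_ideal n p = {p * a mod n | a. a \<in> carrier (residue_ring n)}"
  unfolding res_ideal_def cgenideal_def
  by (simp add: residue_ring_def mod_simps mult.commute)

definition res_hom :: "int \<Rightarrow> int \<Rightarrow> int" where
  "res_hom d a = a mod d"

lemma res_hom_ring_hom:
  assumes "d dvd n" and "1 < d"
  shows "res_hom d \<in> ring_hom (residue_ring n) (residue_ring d)"
  using assms by (auto simp: ring_hom_def res_hom_def residue_ring_def mod_mod_cancel mod_simps)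

lemma res_hom_surj:
  assumes "d dvd n" and "1 < d" and "1 < n"
  shows "res_hom d ` carrier (residue_ring n) = carrier (residue_ring d)"
proof -
  have "d \<le> n" using assms by (simp add: zdvd_imp_le)
  then have "x \<in> res_hom d ` {0..n - 1}" if "x \<in> {0..d - 1}" for x
    using that by (auto simp: res_hom_def intro!: image_eqI[of x _ x])
  then show ?thesis
    using assms(2) by (auto simp: res_hom_def residue_ring_def)
qed

definition Phi :: "int \<Rightarrow> 'd spacetime \<Rightarrow> 'd spacetime" where
  "Phi d u = (\<lambda>i t. res_hom d (u i t))"

text \<open>
  Reduction modulo a divisor intertwines the two automata, but with the reduced coefficient; it is
  the binary projection that allows replacing the unit \<open>c mod d\<close> by \<open>1\<close>.
\<close>

lemma res_hom_lca_uw: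
  assumes "d dvd n"
  shows "res_hom d \<circ> lca_uw J r n c x = lca_uw J r d (res_hom d c) (res_hom d \<circ> x)"
proof
  fix i
  have "(\<Sum>j = 1..J. c * x (i + r j)) mod d
      = (\<Sum>j = 1..J. (c mod d) * (x (i + r j) mod d)) mod d"
    by (subst (1 2) mod_sum_eq[symmetric]) (simp add: mod_mult_eq)
  then show "(res_hom d \<circ> lca_uw J r n c x) i
      = lca_uw J r d (res_hom d c) (res_hom d \<circ> x) i"
    using assms by (simp add: res_hom_def lca_uw_def mod_mod_cancel)
qed

definition binproj :: "'d spacetime \<Rightarrow> 'd spacetime" where
  "binproj u = (\<lambda>i t. if u i t = 0 then 0 else 1)"

end

theory Submission
  imports Defs
begin

text \<open>
  The orbit of the seed is \<open>c ^ t\<close> times an integer path count, reduced modulo \<open>n\<close>. With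
  \<open>d = n / chat\<close>, the coefficient \<open>c\<close> is coprime to \<open>d\<close>, and \<open>chat\<close> divides \<open>c ^ t\<close> once
  \<open>t \<ge> K\<close>. Hence each of the three values vanishes exactly when \<open>d\<close> divides the path count.
\<close>

text \<open>The value at \<open>i\<close> counts the sequences of \<open>t\<close> indices whose
  vectors \<open>r j\<close> lead from \<open>i\<close> to the origin. It is kept as an unreduced
  integer, independent of modulus and coefficient, so that one number serves both automata.\<close>

primrec path_count :: "nat \<Rightarrow> (nat \<Rightarrow> int ^ 'd::finite) \<Rightarrow> nat \<Rightarrow> 'd config" where
  "path_count J r 0 = seed"
| "path_count J r (Suc t) = (\<lambda>i. \<Sum>j = 1..J. path_count J r t (i + r j))"

text \<open>By linearity each step contributes one factor \<open>c\<close>, and all reductions can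
  be postponed to the end. At time 0, \<open>n > 1\<close> makes the seed value 1 its own
  residue.\<close>

lemma seed_orbit_eq:
  assumes "n > 1"
  shows "seed_orbit J r n c i t = c ^ t * path_count J r t i mod n"
proof (induction t arbitrary: i)
  case 0
  then show ?case using assms by (simp add: seed_orbit_def seed_def)
next
  case (Suc t)
  have "seed_orbit J r n c i (Suc t) = (\<Sum>j = 1..J. c * seed_orbit J r n c (i + r j) t) mod n"
    by (simp add: seed_orbit_def lca_uw_def)
  also have "\<dots> = (\<Sum>j = 1..J. c * (c ^ t * path_count J r t (i + r j)) mod n) mod n"
    by (subst (1 2) mod_sum_eq[symmetric]) (simp add: Suc.IH mod_mult_right_eq)
  also have "\<dots> = c ^ Suc t * path_count J r (Suc t) i mod n"
    by (simp add: mod_sum_eq sum_distrib_left mult.assoc)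
  finally show ?case .
qed

text \<open>As \<open>p\<close> divides \<open>n\<close>, reduction modulo \<open>n\<close>
  preserves divisibility by \<open>p\<close>. Conversely, the quotient of \<open>c\<close> by
  \<open>p\<close> lies between 0 and \<open>c\<close>, so it is already a representative.\<close>

lemma mem_res_ideal_iff:
  assumes "p dvd n" and "p > 0" and "c \<in> carrier (residue_ring n)"
  shows "c \<in> res_ideal n p \<longleftrightarrow> p dvd c"
proof
  assume "c \<in> res_ideal n p"
  then show "p dvd c" using assms(1) by (auto simp: res_ideal_eq dvd_mod_iff)
next
  assume "p dvd c"
  then obtain a where a: "c = p * a" ..
  have c: "0 \<le> c" "c < n" using assms(3) by (auto simp: residue_ring_def)
  have "0 \<le> a" using c(1) assms(2) a by (simp add: zero_le_mult_iff)
  moreover have "a \<le> c"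
    using mult_right_mono[of 1 p a] assms(2) a \<open>0 \<le> a\<close> by simp
  ultimately have "a \<in> carrier (residue_ring n)" using c by (simp add: residue_ring_def)
  moreover have "c = p * a mod n" using a c by simp
  ultimately show "c \<in> res_ideal n p" unfolding res_ideal_eq by blast
qed

lemma prod_dvd_of_pairwise_coprime:
  fixes f :: "'a \<Rightarrow> int"
  assumes "finite A" and "\<And>i. i \<in> A \<Longrightarrow> f i dvd x"
    and "\<And>i j. i \<in> A \<Longrightarrow> j \<in> A \<Longrightarrow> i \<noteq> j \<Longrightarrow> coprime (f i) (f j)"
  shows "prod f A dvd x"
  using assms
proof (induction A rule: finite_induct)
  case (insert a A)
  have "coprime (f a) (prod f A)"
    using insert by (intro prod_coprime_right) auto
  then show ?case using insert by (simp add: divides_mult)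
qed simp

theorem theorem1:
  fixes J :: nat and r :: "nat \<Rightarrow> int ^ 'd::finite"
    and n c chat :: int and m K :: nat and p :: "nat \<Rightarrow> int" and k :: "nat \<Rightarrow> nat"
    and I :: "nat set"
  assumes "J \<ge> 1"
    and "n \<ge> 2"
    and "\<And>j. j \<in> {1..m} \<Longrightarrow> prime (p j)"
    and "inj_on p {1..m}"
    and "\<And>j. j \<in> {1..m} \<Longrightarrow> k j \<ge> 1"
    and "n = (\<Prod>j = 1..m. p j ^ k j)"
    and "I \<subset> {1..m}"
    and "c \<in> (carrier (residue_ring n) \<inter> (\<Inter>j\<in>I. res_ideal n (p j)))
             - (\<Union>j\<in>{1..m} - I. res_ideal n (p j))"
    and "chat = (\<Prod>j\<in>I. p j ^ k j)"
    and "K = Max (k ` {1..m})"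
  shows "\<forall>i. \<forall>t\<ge>K.
      binproj (seed_orbit J r n c) i t = binproj (Phi (n div chat) (seed_orbit J r n c)) i t \<and>
      binproj (Phi (n div chat) (seed_orbit J r n c)) i t
        = binproj (seed_orbit J r (n div chat) 1) i t"
proof -
  define d where "d = (\<Prod>j\<in>{1..m} - I. p j ^ k j)"
  have I: "I \<subseteq> {1..m}" and "finite I" using assms(7) finite_subset by auto
  have n: "n = chat * d"
    unfolding assms(6) assms(9) d_def using prod.subset_diff[OF I] by (simp add: mult.commute)
  have "chat \<noteq> 0" using n assms(2) by auto
  then have div: "n div chat = d" using n by simp
  have p_dvd_n: "p j dvd n" if "j \<in> {1..m}" for j
  proof -
    have "p j dvd p j ^ k j" using assms(5)[OF that] by (simp add: dvd_power)
    also have "\<dots> dvd n" unfolding assms(6) using that by (intro dvd_prodI) auto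
    finally show ?thesis .
  qed
  have ideal_iff: "c \<in> res_ideal n (p j) \<longleftrightarrow> p j dvd c" if "j \<in> {1..m}" for j
    using mem_res_ideal_iff[OF p_dvd_n[OF that]] prime_gt_0_int[OF assms(3)[OF that]] assms(8) by auto
  \<comment> \<open>Outside \<open>I\<close>, the prime \<open>p j\<close> does not divide
    \<open>c\<close>, so every factor of \<open>d\<close> is coprime to
    \<open>c ^ t\<close>.\<close>
  have cop: "coprime (c ^ t) d" for t
    unfolding d_def
  proof (intro prod_coprime_right)
    fix j assume j: "j \<in> {1..m} - I"
    then have "\<not> p j dvd c" using ideal_iff[of j] assms(8) by auto
    then have "coprime (p j) c" using assms(3) j by (intro prime_imp_coprime) auto
    then show "coprime (c ^ t) (p j ^ k j)" by (simp add: coprime_commute)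
  qed
  \<comment> \<open>Properness of \<open>I\<close> leaves a prime factor in \<open>d\<close>; thus
    \<open>seed_orbit_eq\<close> also applies with modulus \<open>d\<close>.\<close>
  have "d > 1"
  proof -
    obtain j where j: "j \<in> {1..m} - I" using assms(7) by blast
    have "d > 0" unfolding d_def using assms(3) prime_gt_0_int by (intro prod_pos) auto
    moreover have "p j dvd d"
    proof -
      have "p j dvd p j ^ k j" using assms(5)[of j] j by (simp add: dvd_power)
      also have "\<dots> dvd d" unfolding d_def using j by (intro dvd_prodI) auto
      finally show ?thesis .
    qed
    ultimately show ?thesis
      using prime_gt_1_int[OF assms(3)[of j]] j zdvd_imp_le[of "p j" d] by auto
  qed
  \<comment> \<open>For \<open>j\<close> in \<open>I\<close>, \<open>c ^ t\<close> contains
    \<open>p j\<close> at least \<open>t\<close> times, and \<open>t \<ge> K \<ge> k j\<close>.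
    Powers of distinct primes then combine into their product.\<close>
  have chat_dvd: "chat dvd c ^ t" if "t \<ge> K" for t
    unfolding assms(9)
  proof (rule prod_dvd_of_pairwise_coprime)
    fix j assume j: "j \<in> I"
    then have j': "j \<in> {1..m}" using I by auto
    then have "k j \<le> t" using that unfolding assms(10) by (meson Max_ge finite_atLeastAtMost finite_imageI imageI le_trans)
    moreover have "p j dvd c" using ideal_iff[OF j'] assms(8) j by auto
    ultimately show "p j ^ k j dvd c ^ t" by (meson dvd_power_same dvd_trans le_imp_power_dvd)
  next
    fix i j assume ij: "i \<in> I" "j \<in> I" "i \<noteq> j"
    then have "p i \<noteq> p j" using assms(4) I by (auto dest: inj_onD)
    then have "coprime (p i) (p j)" using ij I assms(3) by (intro primes_coprime) auto
    then show "coprime (p i ^ k i) (p j ^ k j)" by simp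
  qed (fact \<open>finite I\<close>)
  show ?thesis
  proof (intro allI impI)
    fix i t assume t: "K \<le> t"
    let ?N = "path_count J r t i"
    have d_iff: "d dvd c ^ t * ?N \<longleftrightarrow> d dvd ?N"
      using cop[of t] by (simp add: coprime_dvd_mult_right_iff coprime_commute)
    have n_iff: "n dvd c ^ t * ?N \<longleftrightarrow> d dvd ?N"
    proof
      assume "n dvd c ^ t * ?N"
      then show "d dvd ?N" using d_iff n dvd_mult_right by blast
    next
      assume "d dvd ?N"
      \<comment> \<open>The factors are matched separately: \<open>chat\<close> divides
        \<open>c ^ t\<close> and \<open>d\<close> divides the path count. Only this direction uses
        \<open>t \<ge> K\<close>.\<close>
      then show "n dvd c ^ t * ?N" unfolding n using chat_dvd[OF t] by (intro mult_dvd_mono)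
    qed
    have "seed_orbit J r n c i t = 0 \<longleftrightarrow> d dvd ?N"
      using n_iff assms(2) by (simp add: seed_orbit_eq dvd_eq_mod_eq_0)
    \<comment> \<open>Since \<open>d\<close> divides \<open>n\<close>, reducing modulo
      \<open>n\<close> and then \<open>d\<close> is reducing modulo \<open>d\<close>, where the unit
      \<open>c ^ t\<close> does not affect vanishing.\<close>
    moreover have "Phi d (seed_orbit J r n c) i t = 0 \<longleftrightarrow> d dvd ?N"
      using d_iff assms(2) n
      by (simp add: Phi_def res_hom_def seed_orbit_eq mod_mod_cancel dvd_eq_mod_eq_0)
    moreover have "seed_orbit J r d 1 i t = 0 \<longleftrightarrow> d dvd ?N"
      using \<open>d > 1\<close> by (simp add: seed_orbit_eq dvd_eq_mod_eq_0)
    ultimately show "binproj (seed_orbit J r n c) i t = binproj (Phi (n div chat) (seed_orbit J r n c)) i t \<and>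
      binproj (Phi (n div chat) (seed_orbit J r n c)) i t
        = binproj (seed_orbit J r (n div chat) 1) i t"
      unfolding div binproj_def by simp
  qed
qed

end
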